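(* Suppose the following statement ( * ) holds: for all integers $A,a,B,b$ with $A\ge B\ge 0$ and $a\ge b\ge 0$ there is an injection $\gamma:\mathcal{U}^A_b\times\mathcal{U}^B_a\hookrightarrow\mathcal{U}^A_a\times\mathcal{U}^B_b$ such that for all $(\lambda_1,\mu_1)\in\mathcal{U}^A_b\times\mathcal{U}^B_a$, the pair $(\lambda_2,\mu_2)=\gamma((\lambda_1,\mu_1))$ satisfies $\lambda_1\mu_1\trianglerighteq\lambda_2\mu_2$. Then for every sequence of real numbers $p=\{p_n\}_{n\ge0}$, $\mathcal{T}_p\in TN_2$ implies $\mathcal{S}_p\in TN_2$.
   Context: $\mathbb{N}$ is the set of non-negative integers; $[m]=\{1,\ldots,m\}$, $[0]=\emptyset$. A composition with $m$ non-negative parts is a function $\lambda:[m]\to\mathbb{N}$; its weight is $|\lambda|=\sum_{i\in[m]}\lambda(i)$; $\mathcal{U}^m_n$ is the set of such compositions of weight $n$. For $\lambda\in\mathcal{U}^A_a$, $\mu\in\mathcal{U}^B_b$, the concatenation $\lambda\mu\in\mathcal{U}^{A+B}_{a+b}$ is given by $(\lambda\mu)(i)=\lambda(i)$ for $i\in[A]$ and $(\lambda\mu)(i)=\mu(i-A)$ for $i\in[A+B]\setminus[A]$. For $\lambda,\mu\in\mathcal{U}^m$, $\lambda\trianglerighteq\mu$ means that, letting $\lambda_p,\mu_p$ be the non-increasing rearrangements, $|\lambda|=|\mu|$ and $\sum_{i=1}^j\lambda_p(i)\ge\sum_{i=1}^j\mu_p(i)$ for all $1\le j\le m$. $\mathcal{T}_p$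 is the $\mathbb{N}\times\mathbb{N}$ matrix with $(\mathcal{T}_p)_{i,j}=p_{j-i}$ (with $p_n=0$ for $n<0$). With $p(x)=\sum_n p_nx^n$ and $(p^i)_j$ the coefficient of $x^j$ in $(p(x))^i$ (with $(p(x))^0=1$), $\mathcal{S}_p$ is the $\mathbb{N}\times\mathbb{N}$ matrix with $(\mathcal{S}_p)_{i,j}=(p^i)_j$. A matrix is $TN_2$ if all its minors of order at most $2$ are non-negative. *)

theory Defs
  imports
    "Jordan_Normal_Form.Determinant"
    "HOL-Computational_Algebra.Formal_Power_Series"
begin

(* A composition lambda : [m] -> N is the list [lambda(1), ..., lambda(m)], so list
   index i corresponds to argument i + 1, and list append is concatenation. *)
definition compositions :: "nat \<Rightarrow> nat \<Rightarrow> nat list set" where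
  "compositions m n = {xs. length xs = m \<and> sum_list xs = n}"

definition decreasing_rearrangement :: "nat list \<Rightarrow> nat list" where
  "decreasing_rearrangement xs = rev (sort xs)"

definition dominates :: "nat list \<Rightarrow> nat list \<Rightarrow> bool" (infix "\<unrhd>" 50) where
  "xs \<unrhd> ys \<longleftrightarrow>
     length xs = length ys \<and> sum_list xs = sum_list ys \<and>
     (\<forall>j\<in>{1..length xs}.
        sum_list (take j (decreasing_rearrangement xs))
          \<ge> sum_list (take j (decreasing_rearrangement ys)))"

definition toeplitz_matrix :: "(nat \<Rightarrow> real) \<Rightarrow> nat \<Rightarrow> nat \<Rightarrow> real" where
  "toeplitz_matrix p i j = (if i \<le> j then p (j - i) else 0)"

definition power_matrix :: "(nat \<Rightarrow> real) \<Rightarrow> nat \<Rightarrow> nat \<Rightarrow> real" where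
  "power_matrix p i j = fps_nth (Abs_fps p ^ i) j"

(* Rows r 0 < ... < r (k - 1) and columns c 0 < ... < c (k - 1) of an N x N matrix. *)
definition minor :: "(nat \<Rightarrow> nat \<Rightarrow> real) \<Rightarrow> nat \<Rightarrow> (nat \<Rightarrow> nat) \<Rightarrow> (nat \<Rightarrow> nat) \<Rightarrow> real" where
  "minor M k r c = det (mat k k (\<lambda>(a, b). M (r a) (c b)))"

(* The empty minor (order 0) equals 1, so including it imposes no condition. *)
definition totally_nonneg :: "nat \<Rightarrow> (nat \<Rightarrow> nat \<Rightarrow> real) \<Rightarrow> bool" where
  "totally_nonneg n M \<longleftrightarrow>
     (\<forall>k\<le>n. \<forall>r c. strict_mono_on {..<k} r \<longrightarrow> strict_mono_on {..<k} c \<longrightarrow> minor M k r c \<ge> 0)"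

end

theory Submission
  imports Defs
begin

text \<open>
  The coefficient \<open>(p\<^sup>A)\<^sub>b\<close> is the sum of \<open>\<Prod>p(\<lambda>\<^sub>i)\<close> over the compositions \<open>\<lambda>\<close> of \<open>b\<close> into
  \<open>A\<close> parts, so the injection compares the two terms of a minor of order 2 of the power matrix summand
  by summand, once \<open>\<Prod>p(\<lambda>\<^sub>i) \<le> \<Prod>p(\<mu>\<^sub>i)\<close> is known whenever \<open>\<lambda>\<close> dominates \<open>\<mu>\<close>. The Toeplitz
  condition says that \<open>p\<close> is non-negative and log-concave without internal zeros, so this is
  Karamata's inequality for \<open>ln p\<close>, which follows from the supergradient inequality and
  Abel summation.
\<close>

section \<open>Karamata's inequality on an integer interval\<close>

text \<open>By Abel summation, the right side minus the left is the sum over 0 < j < n of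
  \<open>w j - w (j - 1)\<close> times the partial sum of \<open>z\<close> over i < j, and both
  factors are non-negative.\<close>

lemma abel_sum_le:
  fixes w z :: "nat \<Rightarrow> real"
  assumes "\<And>i. Suc i < n \<Longrightarrow> w i \<le> w (Suc i)"
    and "\<And>j. j < n \<Longrightarrow> (\<Sum>i<j. z i) \<ge> 0" and "n > 0"
  shows "(\<Sum>i<n. w i * z i) \<le> w (n - 1) * (\<Sum>i<n. z i)"
  using assms
proof (induction n)
  case (Suc n)
  show ?case
  proof (cases "n = 0")
    case False
    then have IH: "(\<Sum>i<n. w i * z i) \<le> w (n - 1) * (\<Sum>i<n. z i)"
      using Suc by auto
    have "w (n - 1) * (\<Sum>i<n. z i) \<le> w n * (\<Sum>i<n. z i)"
      using Suc.prems(1)[of "n - 1"] Suc.prems(2)[of n] False by (intro mult_right_mono) auto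
    with IH show ?thesis by (simp add: distrib_left)
  qed auto
qed simp

text \<open>The slope \<open>d y\<close> is the backward difference of \<open>f\<close>, antitone by
  concavity. For x > y, f x - f y is a sum of differences at points above y, each at most
  \<open>d y\<close>; for x < y, f y - f x is a sum of differences at points up to y, each at least
  \<open>d y\<close>.\<close>

lemma concave_nat_supergradient:
  fixes f :: "nat \<Rightarrow> real"
  assumes conc: "\<And>k. m \<le> k \<Longrightarrow> Suc (Suc k) \<le> M \<Longrightarrow> f (Suc (Suc k)) - f (Suc k) \<le> f (Suc k) - f k"
  obtains d where "\<And>y y'. m \<le> y \<Longrightarrow> y \<le> y' \<Longrightarrow> y' \<le> M \<Longrightarrow> d y' \<le> d y"
    and "\<And>x y. x \<in> {m..M} \<Longrightarrow> y \<in> {m..M} \<Longrightarrow> f x - f y \<le> d y * (real x - real y)"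
proof -
  \<comment> \<open>At the left endpoint \<open>m\<close> the backward difference would leave the
    interval; \<open>max\<close> replaces it by the forward one, so that
    \<open>d m = d (Suc m)\<close>.\<close>
  define d where "d y = f (max y (Suc m)) - f (max y (Suc m) - 1)" for y
  have d_step: "f (Suc k) = f k + d (Suc k)" if "m \<le> k" for k
    using that by (simp add: d_def)
  have anti: "d y' \<le> d y" if "m \<le> y" "y \<le> y'" "y' \<le> M" for y y'
    using that(2,1,3)
  proof (induction y' rule: dec_induct)
    case (step k)
    have "d (Suc k) \<le> d k"
    proof (cases "k = m")
      case False
      then show ?thesis
        using conc[of "k - 1"] step by (cases k) (auto simp: d_def max_absorb1)
    qed (simp add: d_def)
    with step show ?case by simp
  qed simp
  have up: "f x - f y \<le> d y * (real x - real y)" if "m \<le> y" "y \<le> x" "x \<le> M" for x y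
    using that(2,1,3)
  proof (induction x rule: dec_induct)
    case (step k)
    then show ?case using d_step[of k] anti[of y "Suc k"] by (simp add: algebra_simps)
  qed simp
  have down: "f x - f y \<le> d y * (real x - real y)" if "m \<le> x" "x \<le> y" "y \<le> M" for x y
    using that(2,1,3)
  proof (induction y rule: dec_induct)
    case (step k)
    \<comment> \<open>Moving the base point from k to \<open>Suc k\<close> lowers the slope; since
      it multiplies the non-positive x - k, the upper bound can only grow.\<close>
    have "d (Suc k) * (real k - real x) \<le> d k * (real k - real x)"
      using anti[of k "Suc k"] step by (intro mult_right_mono) auto
    with step show ?case using d_step[of k] by (simp add: algebra_simps)
  qed simp
  show thesis
    using that[of d] anti up down by (metis atLeastAtMost_iff nat_le_linear)
qed

text \<open>Linearise \<open>f\<close> at each \<open>y i\<close>. The slopes are non-decreasing in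
  i because \<open>y\<close> decreases and \<open>d\<close> is antitone, so Abel summation bounds
  the error by a multiple of the total difference, which is zero.\<close>

lemma karamata_nat:
  fixes f :: "nat \<Rightarrow> real"
  assumes conc: "\<And>k. m \<le> k \<Longrightarrow> Suc (Suc k) \<le> M \<Longrightarrow> f (Suc (Suc k)) - f (Suc k) \<le> f (Suc k) - f k"
    and x: "\<And>i. i < n \<Longrightarrow> x i \<in> {m..M}" and y: "\<And>i. i < n \<Longrightarrow> y i \<in> {m..M}"
    and dec: "\<And>i. Suc i < n \<Longrightarrow> y (Suc i) \<le> y i"
    and part: "\<And>j. j < n \<Longrightarrow> (\<Sum>i<j. y i) \<le> (\<Sum>i<j. x i)"
    and tot: "(\<Sum>i<n. y i) = (\<Sum>i<n. x i)"
  shows "(\<Sum>i<n. f (x i)) \<le> (\<Sum>i<n. f (y i))"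
proof (cases "n = 0")
  case False
  obtain d where anti: "\<And>u v. m \<le> u \<Longrightarrow> u \<le> v \<Longrightarrow> v \<le> M \<Longrightarrow> d v \<le> d u"
    and grad: "\<And>u v. u \<in> {m..M} \<Longrightarrow> v \<in> {m..M} \<Longrightarrow> f u - f v \<le> d v * (real u - real v)"
    using concave_nat_supergradient[of m M f] conc by metis
  have "(\<Sum>i<n. f (x i)) - (\<Sum>i<n. f (y i)) \<le> (\<Sum>i<n. d (y i) * (real (x i) - real (y i)))"
    unfolding sum_subtractf[symmetric] using grad x y by (intro sum_mono) auto
  also have "\<dots> \<le> d (y (n - 1)) * (\<Sum>i<n. real (x i) - real (y i))"
  proof (rule abel_sum_le[of n "\<lambda>i. d (y i)" "\<lambda>i. real (x i) - real (y i)"])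
    show "d (y i) \<le> d (y (Suc i))" if "Suc i < n" for i
      using anti[of "y (Suc i)" "y i"] dec[OF that] y[of i] y[of "Suc i"] that by auto
    show "(\<Sum>i<j. real (x i) - real (y i)) \<ge> 0" if "j < n" for j
      using part[OF that] by (simp add: sum_subtractf flip: of_nat_sum)
  qed (use False in simp)
  also have "(\<Sum>i<n. real (x i) - real (y i)) = 0"
    using tot by (simp add: sum_subtractf flip: of_nat_sum)
  finally show ?thesis by simp
qed simp

section \<open>Minors of order at most two and the Toeplitz condition\<close>

lemma minor_0: "minor M 0 r c = 1"
  by (simp add: minor_def)

lemma minor_1: "minor M 1 r c = M (r 0) (c 0)"
  by (simp add: minor_def det_single)

lemma minor_2: "minor M 2 r c = M (r 0) (c 0) * M (r 1) (c 1) - M (r 0) (c 1) * M (r 1) (c 0)"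
  proof -
  define N where "N = mat 2 2 (\<lambda>(a, b). M (r a) (c b))"
  have N: "N \<in> carrier_mat 2 2" by (simp add: N_def)
  have "det N = (\<Sum>j<2. N $$ (0, j) * cofactor N 0 j)"
    using laplace_expansion_row[OF N, of 0] by simp
  also have "\<dots> = N $$ (0, 0) * N $$ (1, 1) - N $$ (0, 1) * N $$ (1, 0)"
    using N by (simp add: numeral_2_eq_2 cofactor_def det_single mat_delete_def)
  finally show ?thesis by (simp add: minor_def N_def)
qed

text \<open>Both matrices are treated through these inequalities, so determinants disappear from the
  rest of the argument.\<close>

lemma totally_nonneg_2_iff:
  "totally_nonneg 2 M \<longleftrightarrow>
     (\<forall>i j. M i j \<ge> 0) \<and>
     (\<forall>i i' j j'. i < i' \<longrightarrow> j < j' \<longrightarrow> M i j' * M i' j \<le> M i j * M i' j')"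
proof (intro iffI conjI allI impI)
  assume M: "totally_nonneg 2 M"
  show "M i j \<ge> 0" for i j
  proof -
    have "strict_mono_on {..<1} (\<lambda>a::nat. i + a)" "strict_mono_on {..<1} (\<lambda>a::nat. j + a)"
      by (auto simp: strict_mono_on_def)
    then have "minor M 1 (\<lambda>a. i + a) (\<lambda>a. j + a) \<ge> 0"
      using M unfolding totally_nonneg_def by (meson one_le_numeral)
    then show ?thesis by (simp add: minor_1[unfolded One_nat_def])
  qed
  show "M i j' * M i' j \<le> M i j * M i' j'" if "i < i'" "j < j'" for i i' j j'
    using M[unfolded totally_nonneg_def, rule_format,
        of 2 "\<lambda>a. if a = 0 then i else i'" "\<lambda>a. if a = 0 then j else j'"] that
    by (auto simp: minor_2 strict_mono_on_def)
next
  assume R: "(\<forall>i j. M i j \<ge> 0) \<and>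
     (\<forall>i i' j j'. i < i' \<longrightarrow> j < j' \<longrightarrow> M i j' * M i' j \<le> M i j * M i' j')"
  show "totally_nonneg 2 M"
    unfolding totally_nonneg_def
  proof (intro allI impI)
    fix k :: nat and r c :: "nat \<Rightarrow> nat"
    assume k: "k \<le> 2" and r: "strict_mono_on {..<k} r" and c: "strict_mono_on {..<k} c"
    from k consider "k = 0" | "k = 1" | "k = 2" by linarith
    then show "minor M k r c \<ge> 0"
    proof cases
      case 3
      then have "r 0 < r 1" "c 0 < c 1" using r c by (auto simp: strict_mono_on_def)
      then show ?thesis using R 3 by (simp add: minor_2)
    qed (use R in \<open>auto simp: minor_0 minor_1[unfolded One_nat_def]\<close>)
  qed
qed

lemma toeplitz_TN2_nonneg:
  assumes "totally_nonneg 2 (toeplitz_matrix p)"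
  shows "p n \<ge> 0"
  using assms unfolding totally_nonneg_2_iff toeplitz_matrix_def by (metis diff_zero le0)

text \<open>Rows 0 and u - x with columns u and y have the entries p u, p y, p x and p (x + y - u).
  Consecutive x, u, y give log-concavity; wider gaps exclude internal zeros.\<close>

lemma toeplitz_TN2_log_concave:
  assumes "totally_nonneg 2 (toeplitz_matrix p)" and "x < u" "u < y"
  shows "p x * p y \<le> p u * p (x + y - u)"
proof -
  have "toeplitz_matrix p 0 y * toeplitz_matrix p (u - x) u
      \<le> toeplitz_matrix p 0 u * toeplitz_matrix p (u - x) y"
    using assms unfolding totally_nonneg_2_iff by (meson zero_less_diff)
  moreover have "y - (u - x) = x + y - u" using assms by linarith
  ultimately show ?thesis using assms by (simp add: toeplitz_matrix_def mult.commute split: if_splits)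
qed

section \<open>Domination and products of coefficients\<close>

lemma sum_list_take_eq_sum:
  "j \<le> length xs \<Longrightarrow> sum_list (take j xs) = (\<Sum>i<j. xs ! i)"
  by (simp add: sum_list_sum_nth atLeast0LessThan)

lemma prod_list_map_decreasing_rearrangement:
  fixes p :: "nat \<Rightarrow> real"
  shows "prod_list (map p xs) = (\<Prod>i<length xs. p (decreasing_rearrangement xs ! i))"
proof -
  have "prod_list (map p xs) = prod_mset (image_mset p (mset (decreasing_rearrangement xs)))"
    by (simp add: decreasing_rearrangement_def flip: prod_mset_prod_list)
  also have "\<dots> = prod_list (map p (decreasing_rearrangement xs))"
    by (simp flip: prod_mset_prod_list)
  also have "\<dots> = (\<Prod>i<length xs. p (decreasing_rearrangement xs ! i))"
    by (simp add: prod.list_conv_set_nth decreasing_rearrangement_def atLeast0LessThan)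
  finally show ?thesis .
qed

lemma decreasing_rearrangement_antimono:
  assumes "i \<le> j" "j < length xs"
  shows "decreasing_rearrangement xs ! j \<le> decreasing_rearrangement xs ! i"
  using assms unfolding decreasing_rearrangement_def
  by (auto simp: rev_nth intro!: sorted_nth_mono)

lemma prod_list_le_if_dominates:
  assumes TN: "totally_nonneg 2 (toeplitz_matrix p)" and dom: "xs \<unrhd> ys"
  shows "prod_list (map p xs) \<le> prod_list (map p ys)"
proof -
  define n where "n = length xs"
  define x where "x = (!) (decreasing_rearrangement xs)"
  define y where "y = (!) (decreasing_rearrangement ys)"
  note p0 = toeplitz_TN2_nonneg[OF TN]
  have len: "length (decreasing_rearrangement xs) = n" "length (decreasing_rearrangement ys) = n"
      "length ys = n"
    using dom by (auto simp: n_def dominates_def decreasing_rearrangement_def)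
  have sums: "(\<Sum>i<n. x i) = sum_list xs" "(\<Sum>i<n. y i) = sum_list ys"
    using sum_list_take_eq_sum[of n "decreasing_rearrangement xs"]
      sum_list_take_eq_sum[of n "decreasing_rearrangement ys"] len
    by (auto simp: x_def y_def decreasing_rearrangement_def simp flip: sum_mset_sum_list)
  have tot: "(\<Sum>i<n. y i) = (\<Sum>i<n. x i)"
    using sums dom by (simp add: dominates_def)
  have part: "(\<Sum>i<j. y i) \<le> (\<Sum>i<j. x i)" if "j \<le> n" for j
  proof (cases "j = 0")
    case False
    then have "sum_list (take j (decreasing_rearrangement ys))
        \<le> sum_list (take j (decreasing_rearrangement xs))"
      using dom that by (simp add: dominates_def n_def)
    then show ?thesis using that len by (simp add: sum_list_take_eq_sum x_def y_def)
  qed simp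
  have x_anti: "x j \<le> x i" and y_anti: "y j \<le> y i" if "i \<le> j" "j < n" for i j
    using decreasing_rearrangement_antimono that len by (auto simp: x_def y_def n_def)
  have prods: "prod_list (map p xs) = (\<Prod>i<n. p (x i))" "prod_list (map p ys) = (\<Prod>i<n. p (y i))"
    using len by (auto simp: prod_list_map_decreasing_rearrangement n_def x_def y_def)
  show ?thesis
  \<comment> \<open>A vanishing factor makes the left product zero while the right one is
    non-negative. Only the remaining case takes logarithms.\<close>
  proof (cases "n = 0 \<or> (\<exists>i<n. p (x i) = 0)")
    case True
    then consider "n = 0" | "(\<Prod>i<n. p (x i)) = 0" by auto
    then have "(\<Prod>i<n. p (x i)) \<le> (\<Prod>i<n. p (y i))"
      by cases (simp, simp only: p0 prod_nonneg)
    then show ?thesis unfolding prods .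
  next
    case False
    then obtain l where n: "n = Suc l" by (cases n) auto
    have px: "p (x i) > 0" if "i < n" for i
      using False p0[of "x i"] that by (auto simp: less_le)
    \<comment> \<open>The first partial sum compares the largest entries; the sum of the first
      \<open>l\<close> entries together with equal totals compares the smallest. So every entry of
      \<open>y\<close> lies between the extremes of \<open>x\<close>.\<close>
    have M: "y 0 \<le> x 0" using part[of 1] n by simp
    have m: "x l \<le> y l" using part[of l] tot n by simp
    have x_range: "x i \<in> {x l..x 0}" and y_range: "y i \<in> {x l..x 0}" if "i < n" for i
      using x_anti[of 0 i] x_anti[of i l] y_anti[of 0 i] y_anti[of i l] M m that n by auto
    \<comment> \<open>The endpoints are entries of \<open>x\<close>, where \<open>p\<close> is
      positive; the absence of internal zeros extends this to all integers between them, so ln p is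
      meaningful wherever Karamata needs it.\<close>
    have pos: "p u > 0" if "u \<in> {x l..x 0}" for u
    proof (cases "u = x l \<or> u = x 0")
      case True
      then show ?thesis using px n by auto
    next
      case False
      then have "p (x l) * p (x 0) \<le> p u * p (x l + x 0 - u)"
        using toeplitz_TN2_log_concave[OF TN] that by auto
      moreover have "p (x l) * p (x 0) > 0" using px n by simp
      ultimately have "p u \<noteq> 0" by auto
      then show ?thesis using p0[of u] by simp
    qed
    have "(\<Sum>i<n. ln (p (x i))) \<le> (\<Sum>i<n. ln (p (y i)))"
    proof (rule karamata_nat[where m = "x l" and M = "x 0" and f = "\<lambda>u. ln (p u)"])
      fix k assume k: "x l \<le> k" "Suc (Suc k) \<le> x 0"
      have pk: "p k > 0" "p (Suc k) > 0" "p (Suc (Suc k)) > 0" using k by (auto intro!: pos)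
      have "p k * p (Suc (Suc k)) \<le> p (Suc k) * p (Suc k)"
        using toeplitz_TN2_log_concave[OF TN, of k "Suc k" "Suc (Suc k)"] by simp
      then have "ln (p k * p (Suc (Suc k))) \<le> ln (p (Suc k) * p (Suc k))"
        using pk by simp
      then show "ln (p (Suc (Suc k))) - ln (p (Suc k)) \<le> ln (p (Suc k)) - ln (p k)"
        using pk by (simp add: ln_mult)
    qed (use x_range y_range y_anti part tot in auto)
    moreover have pxy: "p (x i) > 0" "p (y i) > 0" if "i < n" for i
      using x_range[OF that] y_range[OF that] by (auto intro: pos)
    ultimately have "ln (\<Prod>i<n. p (x i)) \<le> ln (\<Prod>i<n. p (y i))"
      by (subst (1 2) ln_prod) (auto simp: less_imp_neq[symmetric])
    then show ?thesis
      unfolding prods by (subst (asm) ln_le_cancel_iff) (auto intro!: prod_pos pxy)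
  qed
qed

section \<open>Powers of the series as sums over compositions\<close>

lemma compositions_0: "compositions 0 n = (if n = 0 then {[]} else {})"
  by (auto simp: compositions_def)

text \<open>Splitting off the first part mirrors the Cauchy product of p with its m-th power. The
  bound i \<le> n keeps the subtraction n - i exact.\<close>

lemma compositions_Suc:
  "compositions (Suc m) n = (\<lambda>(i, xs). i # xs) ` (SIGMA i:{0..n}. compositions m (n - i))"
proof (intro equalityI subsetI)
  fix ys assume "ys \<in> compositions (Suc m) n"
  then show "ys \<in> (\<lambda>(i, xs). i # xs) ` (SIGMA i:{0..n}. compositions m (n - i))"
    by (cases ys) (force simp: compositions_def)+
qed (auto simp: compositions_def)

lemma finite_compositions: "finite (compositions m n)"
  by (induction m arbitrary: n) (auto simp: compositions_0 compositions_Suc)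

lemma power_matrix_eq_sum:
  "power_matrix p m n = (\<Sum>xs\<in>compositions m n. prod_list (map p xs))"
proof (induction m arbitrary: n)
  case (Suc m)
  have "inj_on (\<lambda>(i, xs). i # xs) (SIGMA i:{0..n}. compositions m (n - i))"
    by (auto simp: inj_on_def)
  then have "(\<Sum>xs\<in>compositions (Suc m) n. prod_list (map p xs))
      = (\<Sum>(i, xs)\<in>(SIGMA i:{0..n}. compositions m (n - i)). p i * prod_list (map p xs))"
    by (simp add: compositions_Suc sum.reindex case_prod_unfold)
  also have "\<dots> = (\<Sum>i=0..n. p i * power_matrix p m (n - i))"
    by (simp add: Suc.IH finite_compositions sum_distrib_left flip: sum.Sigma)
  also have "\<dots> = power_matrix p (Suc m) n"
    by (simp add: power_matrix_def fps_mult_nth)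
  finally show ?case by simp
qed (simp add: power_matrix_def compositions_0)

text \<open>The summand is written on the concatenation because that is what domination
  compares.\<close>

lemma power_matrix_mult_eq_sum:
  "power_matrix p A a * power_matrix p B b =
     (\<Sum>(l, m)\<in>compositions A a \<times> compositions B b. prod_list (map p (l @ m)))"
  by (simp add: power_matrix_eq_sum sum_product sum.cartesian_product)

theorem theorem4:
  fixes p :: "nat \<Rightarrow> real"
  assumes "\<And>A a B b :: nat. A \<ge> B \<Longrightarrow> a \<ge> b \<Longrightarrow>
    \<exists>\<gamma>. inj_on \<gamma> (compositions A b \<times> compositions B a) \<and>
      \<gamma> ` (compositions A b \<times> compositions B a) \<subseteq> compositions A a \<times> compositions B b \<and>
      (\<forall>l1\<in>compositions A b. \<forall>m1\<in>compositions B a. \<forall>l2 m2.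
        \<gamma> (l1, m1) = (l2, m2) \<longrightarrow> l1 @ m1 \<unrhd> l2 @ m2)"
    and "totally_nonneg 2 (toeplitz_matrix p)"
  shows "totally_nonneg 2 (power_matrix p)"
  unfolding totally_nonneg_2_iff
proof (intro conjI allI impI)
  note p0 = toeplitz_TN2_nonneg[OF assms(2)]
  have prod0: "prod_list (map p xs) \<ge> 0" for xs
    by (induction xs) (simp_all add: p0)
  show "power_matrix p i j \<ge> 0" for i j
    unfolding power_matrix_eq_sum by (intro sum_nonneg prod0)
  \<comment> \<open>For rows B < A and columns b < a, the off-diagonal product sums over the domain
    of \<gamma> and the diagonal product over its codomain.\<close>
  fix B A b a :: nat assume "B < A" "b < a"
  then obtain \<gamma> where inj: "inj_on \<gamma> (compositions A b \<times> compositions B a)"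
    and im: "\<gamma> ` (compositions A b \<times> compositions B a) \<subseteq> compositions A a \<times> compositions B b"
    and dom: "\<And>l1 m1 l2 m2. l1 \<in> compositions A b \<Longrightarrow> m1 \<in> compositions B a \<Longrightarrow>
      \<gamma> (l1, m1) = (l2, m2) \<Longrightarrow> l1 @ m1 \<unrhd> l2 @ m2"
    using assms(1)[of B A b a] by (metis less_imp_le)
  define w where "w = (\<lambda>(l, m). prod_list (map p (l @ m)))"
  have "power_matrix p A b * power_matrix p B a = sum w (compositions A b \<times> compositions B a)"
    by (simp add: power_matrix_mult_eq_sum w_def)
  also have "\<dots> \<le> (\<Sum>z\<in>compositions A b \<times> compositions B a. w (\<gamma> z))"
  proof (rule sum_mono)
    fix z assume "z \<in> compositions A b \<times> compositions B a"
    then show "w z \<le> w (\<gamma> z)"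
      using prod_list_le_if_dominates[OF assms(2) dom]
      by (cases z; cases "\<gamma> z") (auto simp: w_def simp del: map_append)
  qed
  also have "\<dots> = sum w (\<gamma> ` (compositions A b \<times> compositions B a))"
    using inj by (simp add: sum.reindex)
  \<comment> \<open>Pairs missed by \<gamma> contribute non-negative terms.\<close>
  also have "\<dots> \<le> sum w (compositions A a \<times> compositions B b)"
    using im prod0 by (intro sum_mono2) (auto simp: finite_compositions w_def simp del: map_append)
  also have "\<dots> = power_matrix p A a * power_matrix p B b"
    by (simp add: power_matrix_mult_eq_sum w_def)
  finally show "power_matrix p B a * power_matrix p A b \<le> power_matrix p B b * power_matrix p A a"
    by (simp add: mult.commute)
qed

end
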